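(* Let $(a_n)_{n\ge1}$ be a sequence of real numbers with $a_n>0$ for all $n$ and $\sum_{n=1}^{\infty}a_n<\infty$. Then $$\sum_{n=1}^{\infty}\left(a_1a_2\cdots a_n\right)^{1/n}\le e\sum_{n=1}^{\infty}\frac{12n+5}{12n+11}\,a_n.$$ It also holds that $$\sum_{n=1}^{\infty}\left(a_1a_2\cdots a_n\right)^{1/n}\le e\sum_{n=1}^{\infty}\left(\frac{12n+5}{12n+11}-\varepsilon_n\right)a_n,$$ where $$\varepsilon_n=\frac{5}{288n^{3}}-\frac{343}{8640n^{4}}+\frac{2621}{41472n^{5}}-\frac{300901}{3483648n^{6}}.$$
   Context: Here $e$ is the base of the natural logarithm. *)

theory Defs
  imports Complex_Main
begin

definition carleman_eps :: "nat \<Rightarrow> real" where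
  "carleman_eps n =
     5 / (288 * real n ^ 3) - 343 / (8640 * real n ^ 4)
     + 2621 / (41472 * real n ^ 5) - 300901 / (3483648 * real n ^ 6)"

text \<open>
  Sequences are indexed from 1; the value at 0 is never used. Accordingly a series
  over \<open>n \<ge> 1\<close> is written as a series over all natural numbers with \<open>Suc n\<close> in place of \<open>n\<close>.
\<close>

definition geom_mean :: "(nat \<Rightarrow> real) \<Rightarrow> nat \<Rightarrow> real" where
  "geom_mean a n = (\<Prod>k=1..n. a k) powr (1 / real n)"

end

theory Submission
  imports Defs "HOL-Analysis.Convex" "HOL-Computational_Algebra.Polynomial"
begin

text \<open>
  Carleman's classical proof reduces both inequalities to one-variable estimates.
  Choose weights \<open>c k = k * (1 + 1/k)^k\<close>, so that \<open>c 1 * ... * c n = (n + 1)^n\<close>. The inequality of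
  arithmetic and geometric means for the numbers \<open>c k * a k\<close> then bounds the \<open>n\<close>-th geometric
  mean by \<open>(\<Sum>k=1..n. c k * a k) / (n * (n + 1))\<close>. Summing over \<open>n\<close> and exchanging the sums, the
  factors \<open>1 / (n * (n + 1))\<close> with \<open>n \<ge> k\<close> telescope to at most \<open>1/k\<close>, and \<open>a k\<close> is left with the
  coefficient \<open>c k / k = (1 + 1/k)^k\<close>. Hence any \<open>v\<close> with \<open>(1 + 1/k)^k \<le> e * v k\<close> gives a
  Carleman inequality (\<open>carleman_inequality_with_factors\<close>).

  Both factors of the theorem are rational functions \<open>f\<close> of \<open>y = 1/k\<close>, which agree with
  \<open>(1 + y)^(1/y) / e\<close> to some order at \<open>y = 0\<close>. Taking logarithms, the claim is that
  \<open>G y = y * (1 + ln (f y)) - ln (1 + y)\<close> is nonnegative on \<open>{0..1}\<close>. Here \<open>G\<close> and \<open>G'\<close> vanish at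
  \<open>0\<close> because \<open>f 0 = 1\<close>, and two derivatives turn both logarithms into rational functions.
  So it suffices that the numerator of \<open>G''\<close>, an explicit polynomial, is nonnegative
  (\<open>one_plus_powr_inverse_le_rational\<close>). For the first factor all its coefficients are
  nonnegative; for the second only the coefficient of \<open>y^12\<close> is negative, and the
  coefficient of \<open>y^11\<close> outweighs it. The sign of \<open>carleman_eps\<close> changes (it is negative at \<open>1\<close>), so
  the two factors are not comparable and each has its own estimate.
\<close>

section \<open>Rational upper bounds for \<open>(1 + y)^(1/y)\<close>\<close>

text \<open>
  For \<open>f = N / D\<close> this is the second derivative of \<open>y * (1 + ln (f y)) - ln (1 + y)\<close>, namely
  \<open>2 * (ln f)' + y * (ln f)'' + 1 / (1 + y)\<^sup>2\<close>, multiplied by \<open>N\<^sup>2 * D\<^sup>2 * (1 + y)\<^sup>2\<close>.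
\<close>
definition convexity_numerator :: "real poly \<Rightarrow> real poly \<Rightarrow> real poly" where
  "convexity_numerator N D =
    ([:2:] * (pderiv N * D - N * pderiv D) * N * D
      + [:0, 1:] * ((pderiv (pderiv N) * N - pderiv N ^ 2) * D ^ 2
                   - (pderiv (pderiv D) * D - pderiv D ^ 2) * N ^ 2)) * [:1, 1:] ^ 2
    + N ^ 2 * D ^ 2"

text \<open>
  A convex \<open>G\<close> with \<open>G 0 = G' 0 = 0\<close> on \<open>{0..1}\<close> is nonnegative there; this is applied to
  \<open>G y = y * (1 + ln (N y / D y)) - ln (1 + y)\<close>. The normalisation \<open>N 0 = D 0\<close> is what makes
  \<open>G' 0\<close> vanish.
\<close>
lemma one_plus_powr_inverse_le_rational:
  fixes N D :: "real poly" and y :: real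
  assumes N: "\<And>x. 0 \<le> x \<Longrightarrow> x \<le> 1 \<Longrightarrow> 0 < poly N x"
    and D: "\<And>x. 0 \<le> x \<Longrightarrow> x \<le> 1 \<Longrightarrow> 0 < poly D x"
    and at_0: "poly N 0 = poly D 0"
    and curv: "\<And>x. 0 \<le> x \<Longrightarrow> x \<le> 1 \<Longrightarrow> 0 \<le> poly (convexity_numerator N D) x"
    and y: "0 < y" "y \<le> 1"
  shows "(1 + y) powr (1 / y) \<le> exp 1 * (poly N y / poly D y)"
proof -
  define G where "G x = x * (1 + ln (poly N x) - ln (poly D x)) - ln (1 + x)" for x
  define G1 where "G1 x = 1 + ln (poly N x) - ln (poly D x)
    + x * (poly (pderiv N) x / poly N x - poly (pderiv D) x / poly D x) - 1 / (1 + x)" for x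
  define G2 where "G2 x = 2 * (poly (pderiv N) x / poly N x - poly (pderiv D) x / poly D x)
    + x * ((poly (pderiv (pderiv N)) x * poly N x - (poly (pderiv N) x)\<^sup>2) / (poly N x)\<^sup>2
         - (poly (pderiv (pderiv D)) x * poly D x - (poly (pderiv D) x)\<^sup>2) / (poly D x)\<^sup>2)
    + 1 / (1 + x)\<^sup>2" for x
  have dG: "(G has_real_derivative G1 x) (at x)" if "0 \<le> x" "x \<le> 1" for x
    unfolding G_def G1_def using N[OF that] D[OF that] that
    by (auto intro!: derivative_eq_intros poly_DERIV simp: algebra_simps)
  have dG1: "(G1 has_real_derivative G2 x) (at x)" if "0 \<le> x" "x \<le> 1" for x
    unfolding G1_def G2_def using N[OF that] D[OF that] that
    by (auto intro!: derivative_eq_intros poly_DERIV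
        simp: power2_eq_square add_divide_distrib diff_divide_distrib algebra_simps)
  have G2: "0 \<le> G2 x" if "0 \<le> x" "x \<le> 1" for x
  proof -
    define n n1 n2 d d1 d2 where nd: "n = poly N x" "n1 = poly (pderiv N) x"
      "n2 = poly (pderiv (pderiv N)) x"
      "d = poly D x" "d1 = poly (pderiv D) x" "d2 = poly (pderiv (pderiv D)) x"
    have pos: "0 < n" "0 < d" "0 < 1 + x"
      using N[OF that] D[OF that] that by (auto simp: nd)
    have "0 \<le> (2 * ((n1 * d - n * d1) * n * d)
        + x * ((n2 * n - n1\<^sup>2) * d\<^sup>2 - (d2 * d - d1\<^sup>2) * n\<^sup>2)) * (1 + x)\<^sup>2
        + n\<^sup>2 * d\<^sup>2"
      using curv[OF that] by (simp add: convexity_numerator_def nd)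
    also have "\<dots> = G2 x * (n\<^sup>2 * d\<^sup>2 * (1 + x)\<^sup>2)"
    proof -
      have "G2 x = 2 * (n1 / n - d1 / d)
          + x * ((n2 * n - n1\<^sup>2) / n\<^sup>2 - (d2 * d - d1\<^sup>2) / d\<^sup>2) + 1 / (1 + x)\<^sup>2"
        by (simp add: G2_def nd)
      also have "\<dots> = (2 * ((n1 * d - n * d1) * n * d)
          + x * ((n2 * n - n1\<^sup>2) * d\<^sup>2 - (d2 * d - d1\<^sup>2) * n\<^sup>2)) / (n\<^sup>2 * d\<^sup>2)
          + 1 / (1 + x)\<^sup>2"
        using pos by (simp add: divide_simps) algebra
      finally have G2_frac: "G2 x = \<dots>" .
      have clear: "P * s + t = (P / t + 1 / s) * (t * s)"
        if "t \<noteq> 0" "s \<noteq> 0" for P s t :: real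
        using that by (simp add: field_simps)
      show ?thesis unfolding G2_frac using pos by (intro clear) auto
    qed
    finally show ?thesis
      by (rule mult_right_le_imp_le[of 0 "n\<^sup>2 * d\<^sup>2 * (1 + x)\<^sup>2", unfolded mult_zero_left])
        (use pos in simp)
  qed
  have "G1 0 \<le> G1 x" if "0 \<le> x" "x \<le> 1" for x
    using that dG1 G2 by (intro DERIV_nonneg_imp_nondecreasing[of 0 x G1]) force+
  moreover have "G1 0 = 0" by (simp add: G1_def at_0)
  ultimately have G1: "0 \<le> G1 x" if "0 \<le> x" "x \<le> 1" for x
    using that by simp
  have "G 0 \<le> G y"
    using y dG G1 by (intro DERIV_nonneg_imp_nondecreasing[of 0 y G]) force+
  hence "ln (1 + y) \<le> y * (1 + ln (poly N y) - ln (poly D y))" by (simp add: G_def)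
  hence "1 / y * ln (1 + y) \<le> 1 + ln (poly N y) - ln (poly D y)"
    using y by (simp add: field_simps)
  hence "exp (1 / y * ln (1 + y)) \<le> exp (1 + (ln (poly N y) - ln (poly D y)))" by simp
  also have "\<dots> = exp 1 * (poly N y / poly D y)"
    using N[of y] D[of y] y by (simp add: exp_add exp_diff)
  finally show ?thesis using y by (simp add: powr_def)
qed

section \<open>The two factors bound \<open>(1 + 1/k)^k\<close>\<close>

lemma first_factor_in_inverse:
  fixes k :: nat
  assumes "1 \<le> k"
  shows "(12 * real k + 5) / (12 * real k + 11)
    = (12 + 5 * (1 / real k)) / (12 + 11 * (1 / real k))"
proof -
  have "12 + 5 * (1 / real k) = (12 * real k + 5) / real k"
    and "12 + 11 * (1 / real k) = (12 * real k + 11) / real k"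
    using assms by (simp_all add: field_simps)
  then show ?thesis using assms by simp
qed

lemma carleman_eps_in_inverse:
  "carleman_eps k = poly [:0, 0, 0, 5/288, - 343/8640, 2621/41472, - 300901/3483648:] (1 / real k)"
  by (simp add: carleman_eps_def eval_nat_numeral ring_distribs)

lemma poly_pCons_nonneg:
  fixes x :: real
  assumes "0 \<le> c" "0 \<le> x" "0 \<le> poly p x"
  shows "0 \<le> poly (pCons c p) x"
  using assms by simp

lemma one_plus_inverse_power_le_first:
  fixes k :: nat
  assumes "1 \<le> k"
  shows "(1 + 1 / real k) ^ k \<le> exp 1 * ((12 * real k + 5) / (12 * real k + 11))"
proof -
  have "(1 + 1 / real k) powr (1 / (1 / real k))
      \<le> exp 1 * (poly [:12, 5:] (1 / real k) / poly [:12, 11:] (1 / real k))"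
  proof (rule one_plus_powr_inverse_le_rational)
    fix x :: real assume x: "0 \<le> x" "x \<le> 1"
    have "0 \<le> x\<^sup>2 * (4320 + x * (7296 + x * 3025))" using x by simp
    then show "0 \<le> poly (convexity_numerator [:12, 5:] [:12, 11:]) x"
      by (simp add: convexity_numerator_def pderiv_pCons power2_eq_square algebra_simps)
  qed (use assms in auto)
  then show ?thesis
    using assms first_factor_in_inverse[of k] by (simp add: powr_realpow add_pos_nonneg mult.commute)
qed

text \<open>
  As a function of \<open>y = 1/k\<close> the second factor is a polynomial of degree \<open>7\<close> over \<open>12 + 11 * y\<close>.
  Its Taylor coefficients at \<open>0\<close> agree with those of \<open>(1 + y)^(1/y) / e\<close> up to \<open>y^6\<close>, so the
  convexity numerator starts with \<open>y^6\<close>.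
\<close>
lemma one_plus_inverse_power_le_second:
  fixes k :: nat
  assumes "1 \<le> k"
  shows "(1 + 1 / real k) ^ k
    \<le> exp 1 * ((12 * real k + 5) / (12 * real k + 11) - carleman_eps k)"
proof -
  \<comment> \<open>Numerator and denominator are multiplied by \<open>17418240\<close>, the least common denominator
    of the coefficients of the numerator over \<open>12 + 11 * x\<close>, to make all coefficients integers.\<close>
  define N D :: "real poly" where
    "N = [:209018880, 87091200, 0, -3628800, 4971456, -5603472, 5945040, 16549555:]" and
    "D = [:209018880, 191600640:]"
  have "(1 + 1 / real k) powr (1 / (1 / real k))
      \<le> exp 1 * (poly N (1 / real k) / poly D (1 / real k))"
  proof (rule one_plus_powr_inverse_le_rational)
    fix x :: real assume x: "0 \<le> x" "x \<le> 1"
    \<comment> \<open>At \<open>x = 1\<close> the two negative terms are still far smaller than the constant term.\<close>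
    have "x ^ 3 \<le> 1" "x ^ 5 \<le> 1" using x by (simp_all add: power_le_one)
    hence "0 < 209018880 - 3628800 * x ^ 3 - 5603472 * x ^ 5" by simp
    also have "\<dots> \<le> poly N x" using x
      by (simp add: N_def algebra_simps eval_nat_numeral)
    finally show "0 < poly N x" .
    have C: "convexity_numerator N D = [:0, 0, 0, 0, 0, 0,
      11606479276962248927451587543040000, 43821073811295302803078845667737600,
      65353451174627609664842598501580800, 47647070229937566963053876163379200,
      16608442131691181939460430784102400, 2056279489886664090015522147532800,
      -28531538672454779010561972633600, 163381331816958061785162291609600,
      483971191470844171398213009408000, 576576376566981691508020740096000,
      305677443696532306471086981120000, 60327843660097567344678666240000:]"
      by (simp add: convexity_numerator_def N_def D_def pderiv_pCons power2_eq_square)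
    \<comment> \<open>The part from \<open>x^11\<close> on contains the only negative coefficient. Since \<open>x \<le> 1\<close>, its
      constant term compensates for it.\<close>
    have tail: "0 \<le> poly [:2056279489886664090015522147532800,
      -28531538672454779010561972633600, 163381331816958061785162291609600,
      483971191470844171398213009408000, 576576376566981691508020740096000,
      305677443696532306471086981120000, 60327843660097567344678666240000:] x"
      (is "0 \<le> poly (pCons ?c (pCons ?d ?p)) x")
    proof -
      have "0 \<le> poly ?p x" by (rule poly_pCons_nonneg | use x in simp)+
      hence "0 \<le> x * (x * poly ?p x)" using x by (simp only: mult_nonneg_nonneg)
      moreover have "0 \<le> ?c + x * ?d" using x by simp
      ultimately show ?thesis by (simp only: poly_pCons distrib_left)
    qed
    show "0 \<le> poly (convexity_numerator N D) x" unfolding C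
      by (rule tail | rule poly_pCons_nonneg | use x in simp)+
  qed (use assms in \<open>auto simp: N_def D_def\<close>)
  moreover have "poly N (1 / real k) / poly D (1 / real k)
      = (12 * real k + 5) / (12 * real k + 11) - carleman_eps k"
  proof -
    have N_eq: "N = smult 17418240 ([:12, 5:] - [:12, 11:]
        * [:0, 0, 0, 5/288, - 343/8640, 2621/41472, - 300901/3483648:])"
      and D_eq: "D = smult 17418240 [:12, 11:]"
      by (simp_all add: N_def D_def)
    have lin: "poly [:12, b:] (1 / real k) = 12 + b * (1 / real k)" for b by simp
    have cancel: "17418240 * (p - d * e) / (17418240 * d) = p / d - e" if "d > 0" for p d e :: real
      using that by (simp add: field_simps)
    show ?thesis
      unfolding N_eq D_eq poly_smult poly_diff poly_mult lin carleman_eps_in_inverse[symmetric]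
        first_factor_in_inverse[OF assms]
      by (rule cancel) (simp add: add_pos_nonneg)
  qed
  ultimately show ?thesis using assms by (simp add: powr_realpow add_pos_nonneg)
qed

section \<open>Carleman's argument\<close>

definition carleman_weight :: "nat \<Rightarrow> real" where
  "carleman_weight k = real k * (1 + 1 / real k) ^ k"

text \<open>
  Since \<open>carleman_weight k = (k + 1)^k / k^(k - 1)\<close>, the product telescopes. Its \<open>n\<close>-th root is \<open>n + 1\<close>,
  which is the point of this choice of weights.
\<close>
lemma prod_carleman_weight: "(\<Prod>k=1..n. carleman_weight k) = real (Suc n) ^ n"
proof (induction n)
  case (Suc n)
  have "1 + 1 / real (Suc n) = real (Suc (Suc n)) / real (Suc n)" by (simp add: field_simps)
  then show ?case using Suc
    by (simp add: carleman_weight_def power_divide del: of_nat_Suc)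
qed simp

lemma geom_mean_le_weighted_sum:
  assumes pos: "\<And>k. k \<ge> 1 \<Longrightarrow> a k > 0" and n: "n \<ge> 1"
  shows "geom_mean a n \<le> (\<Sum>k=1..n. carleman_weight k * a k) / (real n * real (Suc n))"
proof -
  have w: "carleman_weight k > 0" if "k \<ge> 1" for k
    using that by (simp add: carleman_weight_def add_pos_nonneg)
  have root: "(real (Suc n) ^ n) powr (1 / real n) = real (Suc n)"
    using n by (simp add: powr_realpow[symmetric] powr_powr del: of_nat_Suc)
  have "real (Suc n) * geom_mean a n = (\<Prod>k=1..n. carleman_weight k * a k) powr (1 / real n)"
    unfolding prod.distrib prod_carleman_weight geom_mean_def
    using pos by (subst powr_mult) (auto simp: root less_imp_le simp del: of_nat_Suc intro!: prod_nonneg)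
  also have "\<dots> \<le> (\<Sum>k=1..n. carleman_weight k * a k) / real n"
    using arith_geom_mean[of "{1..n}" "\<lambda>k. carleman_weight k * a k"] pos w n
    by (simp add: sum_divide_distrib less_imp_le)
  finally show ?thesis using n by (subst pos_le_divide_eq) (simp, simp add: field_simps)
qed

text \<open>
  The coefficient \<open>1/k - 1/(m + 1)\<close> is the sum of \<open>1 / (n * (n + 1))\<close> over \<open>k \<le> n \<le> m\<close>, which
  results from exchanging the sums. Stating it in closed form lets induction on \<open>m\<close> replace
  the exchange.
\<close>
lemma sum_geom_mean_le:
  assumes pos: "\<And>k. k \<ge> 1 \<Longrightarrow> a k > 0"
  shows "(\<Sum>n=1..m. geom_mean a n)
    \<le> (\<Sum>k=1..m. carleman_weight k * a k * (1 / real k - 1 / real (Suc m)))"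
proof (induction m)
  case (Suc m)
  define S where "S = (\<Sum>k=1..m. carleman_weight k * a k)"
  define q where "q = carleman_weight (Suc m) * a (Suc m)"
  have tele: "1 / (real (Suc m) * real (Suc (Suc m))) = 1 / real (Suc m) - 1 / real (Suc (Suc m))"
    by (simp add: field_simps)
  have "geom_mean a (Suc m) \<le> (S + q) * (1 / (real (Suc m) * real (Suc (Suc m))))"
    using geom_mean_le_weighted_sum[of a "Suc m"] pos by (simp add: S_def q_def)
  also have "\<dots> = S * (1 / real (Suc m) - 1 / real (Suc (Suc m)))
      + q * (1 / real (Suc m) - 1 / real (Suc (Suc m)))"
    unfolding tele by (simp only: distrib_right)
  finally have "(\<Sum>n=1..Suc m. geom_mean a n)
    \<le> (\<Sum>k=1..m. carleman_weight k * a k * (1 / real k - 1 / real (Suc m)))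
      + (S * (1 / real (Suc m) - 1 / real (Suc (Suc m)))
        + q * (1 / real (Suc m) - 1 / real (Suc (Suc m))))"
    using Suc by simp
  also have "\<dots> = (\<Sum>k=1..Suc m. carleman_weight k * a k * (1 / real k - 1 / real (Suc (Suc m))))"
    by (simp add: S_def q_def right_diff_distrib sum_subtractf sum_distrib_right
        sum_divide_distrib distrib_right del: of_nat_Suc)
  finally show ?case .
qed simp

text \<open>
  The partial sums of the geometric means stay below the bound claimed for the series;
  as the terms are nonnegative, this gives convergence and the bound at once.
\<close>
lemma carleman_inequality_with_factors:
  fixes a v :: "nat \<Rightarrow> real"
  assumes pos: "\<And>n. n \<ge> 1 \<Longrightarrow> a n > 0"
    and v: "\<And>n. n \<ge> 1 \<Longrightarrow> (1 + 1 / real n) ^ n \<le> C * v n"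
    and sum: "summable (\<lambda>n. v (Suc n) * a (Suc n))"
  shows "summable (\<lambda>n. geom_mean a (Suc n))"
    and "(\<Sum>n. geom_mean a (Suc n)) \<le> C * (\<Sum>n. v (Suc n) * a (Suc n))"
proof -
  define R where "R = C * (\<Sum>n. v (Suc n) * a (Suc n))"
  have term_le: "(1 + 1 / real n) ^ n * a n \<le> C * (v n * a n)" if "n \<ge> 1" for n
    using mult_right_mono[OF v[OF that], of "a n"] pos[OF that] by (simp add: mult.assoc)
  have bound: "(\<Sum>n<m. geom_mean a (Suc n)) \<le> R" for m
  proof -
    have shift: "(\<Sum>n<m. f (Suc n)) = (\<Sum>n=1..m. f n)" for f :: "nat \<Rightarrow> real"
      by (simp add: sum.shift_bounds_Suc_ivl lessThan_atLeast0 sum.atLeast1_atMost_eq)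
    have "(\<Sum>n<m. geom_mean a (Suc n))
        \<le> (\<Sum>k=1..m. carleman_weight k * a k * (1 / real k - 1 / real (Suc m)))"
      unfolding shift[of "geom_mean a"] using pos by (rule sum_geom_mean_le)
    also have "\<dots> \<le> (\<Sum>k=1..m. C * (v k * a k))"
    proof (rule sum_mono)
      fix k assume "k \<in> {1..m}"
      hence k: "k \<ge> 1" by simp
      have "carleman_weight k * a k * (1 / real k - 1 / real (Suc m))
          \<le> carleman_weight k * a k * (1 / real k)"
        using pos[OF k] by (intro mult_left_mono) (auto simp: carleman_weight_def)
      also have "\<dots> = (1 + 1 / real k) ^ k * a k"
        using k by (simp add: carleman_weight_def)
      finally show "carleman_weight k * a k * (1 / real k - 1 / real (Suc m)) \<le> C * (v k * a k)"
        using term_le[OF k] by simp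
    qed
    also have "\<dots> = (\<Sum>n<m. C * (v (Suc n) * a (Suc n)))"
      by (rule shift[symmetric])
    also have "\<dots> \<le> (\<Sum>n. C * (v (Suc n) * a (Suc n)))"
    proof (rule sum_le_suminf)
      show "0 \<le> C * (v (Suc n) * a (Suc n))" for n
        using term_le[of "Suc n"] pos[of "Suc n"]
        by (intro order_trans[OF _ term_le]) auto
    qed (use sum in \<open>auto intro: summable_mult\<close>)
    also have "\<dots> = R" unfolding R_def using sum by (rule suminf_mult)
    finally show ?thesis .
  qed
  show s: "summable (\<lambda>n. geom_mean a (Suc n))"
    using bound by (intro bounded_imp_summable[where B = R])
      (simp_all add: geom_mean_def flip: lessThan_Suc_atMost del: sum.lessThan_Suc)
  show "(\<Sum>n. geom_mean a (Suc n)) \<le> C * (\<Sum>n. v (Suc n) * a (Suc n))"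
    using suminf_le_const[OF s bound] by (simp add: R_def)
qed

section \<open>The sharpened Carleman inequalities\<close>

text \<open>
  The series with the second factor converges by comparison with \<open>\<Sum>n. a n\<close>, for which a crude
  bound on the correction is enough: the absolute values of its four coefficients sum to
  less than \<open>1\<close>.
\<close>
lemma abs_carleman_eps_le_1: "\<bar>carleman_eps (Suc n)\<bar> \<le> 1"
proof -
  define y where "y = 1 / real (Suc n)"
  have y: "0 \<le> y" "y \<le> 1" by (auto simp: y_def)
  have p: "0 \<le> y ^ j" "y ^ j \<le> 1" for j using y by (auto intro: power_le_one)
  have "carleman_eps (Suc n) = 5 / 288 * y ^ 3 - 343 / 8640 * y ^ 4 + 2621 / 41472 * y ^ 5
      - 300901 / 3483648 * y ^ 6"
    by (simp add: carleman_eps_def y_def power_one_over del: of_nat_Suc)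
  then show ?thesis using p[of 3] p[of 4] p[of 5] p[of 6] by linarith
qed

theorem theorem3:
  fixes a :: "nat \<Rightarrow> real"
  assumes pos: "\<And>n. n \<ge> 1 \<Longrightarrow> a n > 0"
    and conv: "summable (\<lambda>n. a (Suc n))"
  shows "summable (\<lambda>n. geom_mean a (Suc n))
    \<and> summable (\<lambda>n. (12 * real (Suc n) + 5) / (12 * real (Suc n) + 11) * a (Suc n))
    \<and> (\<Sum>n. geom_mean a (Suc n))
        \<le> exp 1 * (\<Sum>n. (12 * real (Suc n) + 5) / (12 * real (Suc n) + 11) * a (Suc n))
    \<and> summable (\<lambda>n. ((12 * real (Suc n) + 5) / (12 * real (Suc n) + 11)
                        - carleman_eps (Suc n)) * a (Suc n))
    \<and> (\<Sum>n. geom_mean a (Suc n))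
        \<le> exp 1 * (\<Sum>n. ((12 * real (Suc n) + 5) / (12 * real (Suc n) + 11)
                        - carleman_eps (Suc n)) * a (Suc n))"
proof -
  define v w :: "nat \<Rightarrow> real" where
    "v n = (12 * real n + 5) / (12 * real n + 11)" and "w n = v n - carleman_eps n" for n
  have v: "\<bar>v n\<bar> \<le> 1" for n by (simp add: v_def)
  have w: "\<bar>w (Suc n)\<bar> \<le> 2" for n
    using v[of "Suc n"] abs_carleman_eps_le_1[of n] by (simp add: w_def)
  have summable_bounded: "summable (\<lambda>n. u (Suc n) * a (Suc n))"
    if u: "\<And>n. \<bar>u (Suc n)\<bar> \<le> 2" for u :: "nat \<Rightarrow> real"
  proof (rule summable_comparison_test')
    show "summable (\<lambda>n. 2 * a (Suc n))" using conv by (rule summable_mult)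
    show "norm (u (Suc n) * a (Suc n)) \<le> 2 * a (Suc n)" for n
      using u[of n] pos[of "Suc n"] by (simp add: abs_mult mult_right_mono)
  qed
  have sv: "summable (\<lambda>n. v (Suc n) * a (Suc n))"
    by (rule summable_bounded) (rule order_trans[OF v], simp)
  have sw: "summable (\<lambda>n. w (Suc n) * a (Suc n))"
    using w by (rule summable_bounded)
  have cv: "(1 + 1 / real n) ^ n \<le> exp 1 * v n" if "n \<ge> 1" for n
    unfolding v_def using that by (rule one_plus_inverse_power_le_first)
  have cw: "(1 + 1 / real n) ^ n \<le> exp 1 * w n" if "n \<ge> 1" for n
    unfolding w_def v_def using that by (rule one_plus_inverse_power_le_second)
  show ?thesis
    using carleman_inequality_with_factors[OF pos cv sv] sv
      carleman_inequality_with_factors(2)[OF pos cw sw] sw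
    unfolding v_def w_def by blast
qed

end
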